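(* For integers $a,b\geq 1$, the graph $\mathcal{F}_{(a,1,b,1)}$ is isomorphic to an $a\times b$ rectangular grid with one pending edge attached to each node (i.e., each grid node gets a new private neighbor of degree 1). Consequently, it does not have a Hamilton path unless $a\cdot b\leq 2$.
   Context: Let $N=a+b+2$ and label the points of a convex $N$-gon $1,\ldots,N$ counterclockwise; color them according to the pattern: $a$ red points, then $1$ blue point, then $b$ red points, then $1$ blue point. The associahedron $\mathcal{G}_N$ has as nodes all triangulations of the convex $N$-gon, two adjacent if they differ in a flip (removing a diagonal shared by two triangles and replacing it by the other diagonal of the resulting quadrilateral). A triangulation is colorful if no triangle has all three points of the same color; $\mathcal{F}_{(a,1,b,1)}$ is the subgraph of $\mathcal{G}_N$ induced by the colorful triangulations. *)

theory Defs
  imports "Graph_Theory.Graph_Theory"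
begin

text \<open>Points of the convex \<open>N\<close>-gon are \<open>1, \<dots>, N\<close> in counterclockwise order;
  a segment between two points is the two-element set of its endpoints.\<close>

definition polygon_edges :: "nat \<Rightarrow> nat set set" where
  "polygon_edges N = insert {1, N} {{i, Suc i} | i. 1 \<le> i \<and> i < N}"

definition diagonals :: "nat \<Rightarrow> nat set set" where
  "diagonals N = {{i, j} | i j. i \<in> {1..N} \<and> j \<in> {1..N} \<and> i \<noteq> j} - polygon_edges N"

text \<open>For points in convex position, two segments cross in their interiors iff their
  endpoints are distinct and alternate around the polygon.\<close>

definition crossing :: "nat set \<Rightarrow> nat set \<Rightarrow> bool" where
  "crossing d e \<longleftrightarrow> (\<exists>i j k l. i < j \<and> j < k \<and> k < l \<and>
     (d = {i, k} \<and> e = {j, l} \<or> d = {j, l} \<and> e = {i, k}))"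

definition noncrossing :: "nat set set \<Rightarrow> bool" where
  "noncrossing T \<longleftrightarrow> (\<forall>d\<in>T. \<forall>e\<in>T. \<not> crossing d e)"

text \<open>A triangulation is represented by its set of diagonals: an inclusion-maximal set
  of pairwise noncrossing diagonals.\<close>

definition triangulations :: "nat \<Rightarrow> nat set set set" where
  "triangulations N = {T. T \<subseteq> diagonals N \<and> noncrossing T \<and>
     (\<forall>T'. T \<subseteq> T' \<and> T' \<subseteq> diagonals N \<and> noncrossing T' \<longrightarrow> T' = T)}"

text \<open>Since the points are in convex position, any three points pairwise joined by
  polygon edges or diagonals of \<open>T\<close> span a face of the triangulation.\<close>

definition triangles :: "nat \<Rightarrow> nat set set \<Rightarrow> nat set set" where
  "triangles N T = {{x, y, z} | x y z. distinct [x, y, z] \<and>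
     {{x, y}, {y, z}, {x, z}} \<subseteq> polygon_edges N \<union> T}"

definition flip :: "nat \<Rightarrow> nat set set \<Rightarrow> nat set set \<Rightarrow> bool" where
  "flip N T T' \<longleftrightarrow> (\<exists>p q r s. {p, q} \<in> T \<and> r \<noteq> s \<and>
     {p, q, r} \<in> triangles N T \<and> {p, q, s} \<in> triangles N T \<and>
     T' = insert {r, s} (T - {{p, q}}))"

text \<open>Undirected graphs are symmetric digraphs: each edge is a pair of opposite arcs.\<close>

definition associahedron :: "nat \<Rightarrow> nat set set pair_pre_digraph" where
  "associahedron N = \<lparr> pverts = triangulations N,
     parcs = {(T, T'). T \<in> triangulations N \<and> T' \<in> triangulations N \<and> flip N T T'} \<rparr>"

datatype color = Red | Blue

definition point_color :: "nat \<Rightarrow> nat \<Rightarrow> nat \<Rightarrow> color" where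
  "point_color a b i = (replicate a Red @ [Blue] @ replicate b Red @ [Blue]) ! (i - 1)"

definition colorful :: "nat \<Rightarrow> (nat \<Rightarrow> color) \<Rightarrow> nat set set \<Rightarrow> bool" where
  "colorful N col T \<longleftrightarrow> (\<forall>t\<in>triangles N T. \<not> (\<exists>c. \<forall>x\<in>t. col x = c))"

definition colorful_flip_graph ::
  "nat \<Rightarrow> nat \<Rightarrow> (nat set set, nat set set \<times> nat set set) pre_digraph" where
  "colorful_flip_graph a b =
     induce_subgraph (with_proj (associahedron (a + b + 2)))
       {T \<in> triangulations (a + b + 2). colorful (a + b + 2) (point_color a b) T}"

definition grid_graph :: "nat \<Rightarrow> nat \<Rightarrow> (nat \<times> nat) pair_pre_digraph" where
  "grid_graph a b = \<lparr> pverts = {1..a} \<times> {1..b},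
     parcs = {((i, j), (k, l)). (i, j) \<in> {1..a} \<times> {1..b} \<and> (k, l) \<in> {1..a} \<times> {1..b} \<and>
       (i = k \<and> (l = Suc j \<or> j = Suc l) \<or> j = l \<and> (k = Suc i \<or> i = Suc k))} \<rparr>"

text \<open>\<open>Inl v\<close> is the node \<open>v\<close> of the given graph and \<open>Inr v\<close> its new private neighbor.\<close>

definition attach_pendants :: "'a pair_pre_digraph \<Rightarrow> ('a + 'a) pair_pre_digraph" where
  "attach_pendants G = \<lparr> pverts = Inl ` pverts G \<union> Inr ` pverts G,
     parcs = {(Inl u, Inl v) | u v. (u, v) \<in> parcs G} \<union>
       {(Inl v, Inr v) | v. v \<in> pverts G} \<union> {(Inr v, Inl v) | v. v \<in> pverts G} \<rparr>"

definition has_hamilton_path :: "('a, 'b) pre_digraph \<Rightarrow> bool" where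
  "has_hamilton_path G \<longleftrightarrow> (\<exists>u p v. pre_digraph.apath G u p v \<and>
     set (pre_digraph.awalk_verts G u p) = verts G)"

end

theory Submission
  imports Defs
begin

text \<open>
  Let \<open>P = a + 1\<close> and \<open>N = a + b + 2\<close> be the blue points. A red diagonal with both ends on the same
  red arc would cut off an all-red triangle, and two distinct diagonals crossing \<open>{P, N}\<close> would
  force an all-red triangle between them. So a colorful triangulation has exactly one diagonal of
  the form \<open>{P, N}\<close> or \<open>{i, P + j}\<close> (with \<open>i\<close> and \<open>P + j\<close> red), and the rest are spokes: \<open>N\<close> is joined
  to \<open>1, \<dots>, i\<close> and to \<open>P + j, \<dots>, N - 1\<close>, and \<open>P\<close> is joined to \<open>i, \<dots>, P + j\<close>.
  With \<open>{P, N}\<close> the pair \<open>(i, j)\<close> is a grid node: flipping a spoke moves \<open>i\<close> or \<open>j\<close> by one, and flipping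
  \<open>{P, N}\<close> yields the triangulation with \<open>{i, P + j}\<close>, whose only colorful flip is the one back.
  All other pairs differ in more than one diagonal. A vertex with a unique neighbor can only be an
  end of a path, so a Hamilton path leaves room for at most two pendant nodes.
\<close>

section \<open>Triangulations in terms of ordered endpoints\<close>

lemma doubleton_eq_ordered_iff:
  fixes x y u v :: nat
  assumes "x < y" "u < v"
  shows "{x, y} = {u, v} \<longleftrightarrow> x = u \<and> y = v"
  using assms by (auto simp: doubleton_eq_iff)

lemma crossing_iff:
  assumes "x < y" "u < v"
  shows "crossing {x, y} {u, v} \<longleftrightarrow> x < u \<and> u < y \<and> y < v \<or> u < x \<and> x < v \<and> v < y"
proof
  assume "crossing {x, y} {u, v}"
  then obtain i j k l where *: "i < j" "j < k" "k < l"
    "{x, y} = {i, k} \<and> {u, v} = {j, l} \<or> {x, y} = {j, l} \<and> {u, v} = {i, k}"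
    unfolding crossing_def by blast
  then have "i < k" "j < l" by auto
  with * assms show "x < u \<and> u < y \<and> y < v \<or> u < x \<and> x < v \<and> v < y"
    by (auto simp: doubleton_eq_ordered_iff)
next
  assume "x < u \<and> u < y \<and> y < v \<or> u < x \<and> x < v \<and> v < y"
  then show "crossing {x, y} {u, v}"
    unfolding crossing_def by blast
qed

lemma polygon_edges_iff:
  assumes "x < y" "2 \<le> N"
  shows "{x, y} \<in> polygon_edges N \<longleftrightarrow> 1 \<le> x \<and> y \<le> N \<and> (y = Suc x \<or> x = 1 \<and> y = N)"
  using assms by (auto simp: polygon_edges_def doubleton_eq_iff)

lemma diagonals_iff:
  assumes "x < y" "2 \<le> N"
  shows "{x, y} \<in> diagonals N \<longleftrightarrow> 1 \<le> x \<and> Suc (Suc x) \<le> y \<and> y \<le> N \<and> \<not> (x = 1 \<and> y = N)"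
proof -
  have "{x, y} \<in> {{i, j} | i j. i \<in> {1..N} \<and> j \<in> {1..N} \<and> i \<noteq> j} \<longleftrightarrow> 1 \<le> x \<and> y \<le> N"
    using assms(1) by (fastforce simp: doubleton_eq_iff)
  then show ?thesis
    using assms by (auto simp: diagonals_def polygon_edges_iff)
qed

lemma diagonalsE:
  assumes "d \<in> diagonals N"
  obtains x y where "x < y" "d = {x, y}"
proof -
  obtain i j where "d = {i, j}" "i \<noteq> j"
    using assms by (auto simp: diagonals_def)
  then show thesis
    using that[of i j] that[of j i] by (cases "i < j") (auto simp: insert_commute)
qed

lemma diagonal_sets_eqI:
  assumes "A \<subseteq> diagonals N" "B \<subseteq> diagonals N"
    and "\<And>x y. x < y \<Longrightarrow> {x, y} \<in> A \<longleftrightarrow> {x, y} \<in> B"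
  shows "A = B"
proof (rule set_eqI)
  fix d
  show "d \<in> A \<longleftrightarrow> d \<in> B"
  proof (cases "d \<in> diagonals N")
    case True
    then obtain x y where "x < y" "d = {x, y}" by (rule diagonalsE)
    then show ?thesis using assms(3) by simp
  qed (use assms(1,2) in blast)
qed

text \<open>Swapping the two members covers the other crossing pattern, so \<open>nc\<close> lists
  only one. By \<open>max\<close>, every further diagonal crosses a member, so no larger noncrossing
  set exists.\<close>

lemma triangulationsI:
  assumes "T \<subseteq> diagonals N"
    and nc: "\<And>x y u v. \<lbrakk>{x, y} \<in> T; {u, v} \<in> T; x < u; u < y; y < v\<rbrakk> \<Longrightarrow> False"
    and max: "\<And>x y. \<lbrakk>x < y; {x, y} \<in> diagonals N; {x, y} \<notin> T\<rbrakk>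
      \<Longrightarrow> \<exists>u v. {u, v} \<in> T \<and> (x < u \<and> u < y \<and> y < v \<or> u < x \<and> x < v \<and> v < y)"
  shows "T \<in> triangulations N"
proof -
  have "noncrossing T"
    unfolding noncrossing_def
  proof (intro ballI notI)
    fix d e assume de: "d \<in> T" "e \<in> T" "crossing d e"
    obtain x y where "x < y" "d = {x, y}"
      using assms(1) de(1) by (meson diagonalsE subsetD)
    moreover obtain u v where "u < v" "e = {u, v}"
      using assms(1) de(2) by (meson diagonalsE subsetD)
    moreover note de
    ultimately show False
      using nc by (auto simp: crossing_iff)
  qed
  moreover have "T' = T" if T': "T \<subseteq> T'" "T' \<subseteq> diagonals N" "noncrossing T'" for T'
  proof (rule ccontr)
    assume "T' \<noteq> T"
    then obtain d where d: "d \<in> T'" "d \<notin> T" using T' by blast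
    then obtain x y where xy: "x < y" "d = {x, y}" using T'(2) by (meson diagonalsE subsetD)
    then obtain u v where uv: "{u, v} \<in> T" "x < u \<and> u < y \<and> y < v \<or> u < x \<and> x < v \<and> v < y"
      using max[of x y] d T' by blast
    then have "crossing {x, y} {u, v}"
      using xy by (subst crossing_iff) auto
    then show False
      using T' d xy uv by (auto simp: noncrossing_def)
  qed
  ultimately show ?thesis
    using assms(1) by (auto simp: triangulations_def)
qed

section \<open>Edges of a fixed triangulation\<close>

locale triangulation =
  fixes N :: nat and T :: "nat set set"
  assumes two_le_N: "2 \<le> N" and triangulation: "T \<in> triangulations N"
begin

lemma subset_diagonals: "T \<subseteq> diagonals N"
  using triangulation by (simp add: triangulations_def)

lemma maximal: "\<lbrakk>T' \<in> triangulations N; T \<subseteq> T'\<rbrakk> \<Longrightarrow> T = T'"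
  using triangulation by (auto simp: triangulations_def)

lemma edge_bounds:
  assumes "{x, y} \<in> polygon_edges N \<union> T" "x < y"
  shows "1 \<le> x" "y \<le> N"
  using assms subset_diagonals two_le_N
  by (auto simp: polygon_edges_iff diagonals_iff dest!: subsetD[of T])

text \<open>Sides and diagonals can be treated alike: a polygon side joins consecutive points or
  encloses the whole range \<open>1..N\<close>, so nothing interleaves with it.\<close>

lemma edges_noncrossing:
  assumes "{x, y} \<in> polygon_edges N \<union> T" "{u, v} \<in> polygon_edges N \<union> T"
    and "x < u" "u < y" "y < v"
  shows False
proof (cases "{x, y} \<in> T \<and> {u, v} \<in> T")
  case True
  moreover have "crossing {x, y} {u, v}"
    using assms by (subst crossing_iff) auto
  ultimately show False
    using triangulation by (auto simp: triangulations_def noncrossing_def)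
next
  case False
  then show False
    using assms edge_bounds[of x y] edge_bounds[of u v] two_le_N
    by (auto simp: polygon_edges_iff)
qed

text \<open>Adding an uncrossed segment keeps the set noncrossing, so by maximality it was there
  already. The bounds on \<open>u\<close> and \<open>v\<close> granted in the last two premises come
  from \<open>edge_bounds\<close> and spare later uses a separate argument.\<close>

lemma edge_if_uncrossed:
  assumes "x < y" "1 \<le> x" "y \<le> N"
    and "\<And>u v. \<lbrakk>{u, v} \<in> T; 1 \<le> u; u < x; x < v; v < y\<rbrakk> \<Longrightarrow> False"
    and "\<And>u v. \<lbrakk>{u, v} \<in> T; v \<le> N; x < u; u < y; y < v\<rbrakk> \<Longrightarrow> False"
  shows "{x, y} \<in> polygon_edges N \<union> T"
proof (rule ccontr)
  assume *: "{x, y} \<notin> polygon_edges N \<union> T"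
  then have diag: "{x, y} \<in> diagonals N"
    using assms two_le_N by (auto simp: polygon_edges_iff diagonals_iff)
  have uncrossed: "\<not> crossing {x, y} e \<and> \<not> crossing e {x, y}" if e: "e \<in> T" for e
  proof -
    obtain u v where "u < v" "e = {u, v}"
      using e subset_diagonals by (meson diagonalsE subsetD)
    then show ?thesis
      using e assms edge_bounds[of u v] by (auto simp: crossing_iff)
  qed
  moreover have "\<not> crossing {x, y} {x, y}"
    using assms by (simp add: crossing_iff)
  ultimately have "noncrossing (insert {x, y} T)"
    using triangulation by (auto simp: noncrossing_def triangulations_def)
  then have "insert {x, y} T = T"
    using triangulation diag by (auto simp: triangulations_def)
  with * show False by blast
qed

text \<open>The apex of the triangle on the inner side is the last neighbor \<open>z\<close> of
  \<open>x\<close> before \<open>y\<close>: a member crossing \<open>{z, y}\<close> would cross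
  \<open>{x, y}\<close> or \<open>{x, z}\<close>, or join \<open>x\<close> to a point after
  \<open>z\<close>.\<close>

lemma inner_apex:
  assumes xy: "{x, y} \<in> polygon_edges N \<union> T" and "Suc x < y"
  obtains z where "x < z" "z < y"
    "{x, z} \<in> polygon_edges N \<union> T" "{z, y} \<in> polygon_edges N \<union> T"
proof -
  let ?Z = "{z. x < z \<and> z < y \<and> {x, z} \<in> polygon_edges N \<union> T}"
  define z where "z = Max ?Z"
  have bounds: "1 \<le> x" "y \<le> N" using edge_bounds[OF xy] assms by auto
  have "Suc x \<in> ?Z"
    using assms bounds two_le_N by (auto simp: polygon_edges_iff)
  moreover have fin: "finite ?Z" by simp
  ultimately have z: "z \<in> ?Z" unfolding z_def by (metis (no_types) Max_in empty_iff)
  have z_max: "w \<le> z" if "w \<in> ?Z" for w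
    unfolding z_def using that fin by (rule Max_ge[rotated])
  have "{z, y} \<in> polygon_edges N \<union> T"
  proof (rule edge_if_uncrossed)
    show "z < y" "1 \<le> z" "y \<le> N" using z bounds by auto
  next
    fix u v assume uv: "{u, v} \<in> T" "1 \<le> u" "u < z" "z < v" "v < y"
    consider "u < x" | "u = x" | "x < u" by linarith
    then show False
    proof cases
      case 1 then show False using edges_noncrossing[of u v x y] uv xy z by auto
    next
      case 2 then show False using z_max[of v] uv z by auto
    next
      case 3 then show False using edges_noncrossing[of x z u v] uv z by auto
    qed
  next
    fix u v assume uv: "{u, v} \<in> T" "v \<le> N" "z < u" "u < y" "y < v"
    then show False using edges_noncrossing[of x y u v] xy z by auto
  qed
  then show thesis using that z by blast
qed

end

section \<open>Flips\<close>

lemma flip_quadrilateral: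
  assumes order: "w < x" "x < y" "y < z"
    and sides: "{w, x} \<in> polygon_edges N \<union> T" "{x, y} \<in> polygon_edges N \<union> T"
      "{y, z} \<in> polygon_edges N \<union> T" "{w, z} \<in> polygon_edges N \<union> T"
    and T: "{w, y} \<in> T" "{x, z} \<notin> T" "T' = insert {x, z} (T - {{w, y}})"
  shows "flip N T T'" "flip N T' T"
proof -
  have tri: "{p, q, r} \<in> triangles N S"
    if "distinct [p, q, r]" "{p, q} \<in> polygon_edges N \<union> S" "{q, r} \<in> polygon_edges N \<union> S"
      "{p, r} \<in> polygon_edges N \<union> S" for p q r S
    using that unfolding triangles_def by blast
  \<comment> \<open>No side equals the diagonal \<open>{w, y}\<close>, so all four survive the
    exchange and the reverse flip happens in the same quadrilateral.\<close>
  have sides': "{w, x} \<in> polygon_edges N \<union> T'" "{x, y} \<in> polygon_edges N \<union> T'"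
      "{y, z} \<in> polygon_edges N \<union> T'" "{w, z} \<in> polygon_edges N \<union> T'"
    using sides order unfolding T(3) by (auto simp: doubleton_eq_iff)
  have "{w, y, x} \<in> triangles N T" "{w, y, z} \<in> triangles N T"
    using order sides T by (auto intro!: tri simp: insert_commute)
  moreover have "x \<noteq> z" using order by simp
  ultimately show "flip N T T'"
    unfolding flip_def using T by blast
  have T': "T = insert {w, y} (T' - {{x, z}})" "{x, z} \<in> T'" "w \<noteq> y"
    using T order by (auto simp: doubleton_eq_iff)
  moreover have "{x, z, w} \<in> triangles N T'" "{x, z, y} \<in> triangles N T'"
    using order sides' T'(2) by (auto intro!: tri simp: insert_commute)
  ultimately show "flip N T' T"
    unfolding flip_def by blast
qed

text \<open>All negative results on flips rest on this: two different lost diagonals, or no change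
  at all, exclude a flip.\<close>

lemma flip_diff:
  assumes "flip N T T'"
  shows "T \<noteq> T'"
    and "\<lbrakk>d \<in> T; d \<notin> T'; e \<in> T; e \<notin> T'\<rbrakk> \<Longrightarrow> d = e"
    and "\<lbrakk>d \<in> T'; d \<notin> T; e \<in> T'; e \<notin> T\<rbrakk> \<Longrightarrow> d = e"
proof -
  obtain p q r s where *: "{p, q} \<in> T" "{p, q, r} \<in> triangles N T"
    "T' = insert {r, s} (T - {{p, q}})"
    using assms unfolding flip_def by blast
  \<comment> \<open>Corners of a triangle are distinct, so \<open>r\<close> is neither
    \<open>p\<close> nor \<open>q\<close>, and inserting \<open>{r, s}\<close> cannot restore
    \<open>{p, q}\<close>.\<close>
  then have "card {p, q, r} = 3"
    by (auto simp: triangles_def)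
  then have "r \<notin> {p, q}"
    by (auto simp: card_insert_if split: if_splits)
  then have "{p, q} \<notin> T'"
    using * by auto
  then show "T \<noteq> T'" using * by blast
  show "\<lbrakk>d \<in> T; d \<notin> T'; e \<in> T; e \<notin> T'\<rbrakk> \<Longrightarrow> d = e"
    and "\<lbrakk>d \<in> T'; d \<notin> T; e \<in> T'; e \<notin> T\<rbrakk> \<Longrightarrow> d = e"
    using * by auto
qed

section \<open>Colorful triangulations\<close>

text \<open>Meant for \<open>x < y\<close>: the segments shared by the grid triangulation and its
  pendant at \<open>(i, j)\<close>. Some polygon sides qualify too; the intersection with
  \<open>diagonals\<close> removes them.\<close>

definition spoke :: "nat \<Rightarrow> nat \<Rightarrow> nat \<Rightarrow> nat \<Rightarrow> nat \<Rightarrow> nat \<Rightarrow> bool" where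
  "spoke a b i j x y \<longleftrightarrow> y = a + 1 \<and> i \<le> x \<or> x = a + 1 \<and> y \<le> a + 1 + j \<or>
     y = a + b + 2 \<and> (x \<le> i \<or> a + 1 + j \<le> x)"

definition grid_tri :: "nat \<Rightarrow> nat \<Rightarrow> nat \<Rightarrow> nat \<Rightarrow> nat set set" where
  "grid_tri a b i j = {d \<in> diagonals (a + b + 2).
     \<exists>x y. x < y \<and> d = {x, y} \<and> (spoke a b i j x y \<or> x = a + 1 \<and> y = a + b + 2)}"

definition pendant_tri :: "nat \<Rightarrow> nat \<Rightarrow> nat \<Rightarrow> nat \<Rightarrow> nat set set" where
  "pendant_tri a b i j = {d \<in> diagonals (a + b + 2).
     \<exists>x y. x < y \<and> d = {x, y} \<and> (spoke a b i j x y \<or> x = i \<and> y = a + 1 + j)}"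

lemma grid_tri_subset: "grid_tri a b i j \<subseteq> diagonals (a + b + 2)"
  by (auto simp: grid_tri_def)

lemma pendant_tri_subset: "pendant_tri a b i j \<subseteq> diagonals (a + b + 2)"
  by (auto simp: pendant_tri_def)

lemma grid_tri_iff:
  assumes "x < y"
  shows "{x, y} \<in> grid_tri a b i j \<longleftrightarrow> {x, y} \<in> diagonals (a + b + 2) \<and>
    (spoke a b i j x y \<or> x = a + 1 \<and> y = a + b + 2)"
  using assms by (auto simp: grid_tri_def doubleton_eq_ordered_iff cong: conj_cong)

lemma pendant_tri_iff:
  assumes "x < y"
  shows "{x, y} \<in> pendant_tri a b i j \<longleftrightarrow> {x, y} \<in> diagonals (a + b + 2) \<and>
    (spoke a b i j x y \<or> x = i \<and> y = a + 1 + j)"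
  using assms by (auto simp: pendant_tri_def doubleton_eq_ordered_iff cong: conj_cong)

lemmas tri_simps = grid_tri_iff pendant_tri_iff diagonals_iff polygon_edges_iff spoke_def

lemma point_color_eq_Blue_iff:
  assumes "1 \<le> x" "x \<le> a + b + 2"
  shows "point_color a b x = Blue \<longleftrightarrow> x = a + 1 \<or> x = a + b + 2"
  using assms by (auto simp: point_color_def nth_append nth_Cons' split: if_splits)

lemma ex_all_eq_color_iff:
  "(\<exists>c. \<forall>x\<in>t. col x = c) \<longleftrightarrow> (\<forall>x\<in>t. col x = Blue) \<or> (\<forall>x\<in>t. col x \<noteq> Blue)"
  by (metis (full_types) color.exhaust)

lemma ordered_triangleE:
  assumes "t \<in> triangles N T"
  obtains x y z where "x < y" "y < z" "t = {x, y, z}" "{x, y} \<in> polygon_edges N \<union> T"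
    "{y, z} \<in> polygon_edges N \<union> T" "{x, z} \<in> polygon_edges N \<union> T"
proof -
  obtain x y z where t: "t = {x, y, z}" "distinct [x, y, z]"
    and "{{x, y}, {y, z}, {x, z}} \<subseteq> polygon_edges N \<union> T"
    using assms unfolding triangles_def mem_Collect_eq by (elim exE conjE)
  then have e: "{x, y} \<in> polygon_edges N \<union> T" "{y, z} \<in> polygon_edges N \<union> T"
    "{x, z} \<in> polygon_edges N \<union> T"
    by simp_all
  have e': "{y, x} \<in> polygon_edges N \<union> T" "{z, y} \<in> polygon_edges N \<union> T" "{z, x} \<in> polygon_edges N \<union> T"
    using e by (simp_all add: insert_commute)
  have t': "t = {x, z, y}" "t = {y, x, z}" "t = {y, z, x}" "t = {z, x, y}" "t = {z, y, x}"
    using t(1) by auto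
  consider "x < y" "y < z" | "x < z" "z < y" | "y < x" "x < z"
    | "y < z" "z < x" | "z < x" "x < y" | "z < y" "y < x"
    using t(2)
    by (cases x y rule: linorder_cases; cases y z rule: linorder_cases;
        cases x z rule: linorder_cases) auto
  then show thesis
  proof cases
    case 1 show thesis by (rule that[OF 1 t(1) e])
  next
    case 2 show thesis by (rule that[OF 2 t'(1) e(3) e'(2) e(1)])
  next
    case 3 show thesis by (rule that[OF 3 t'(2) e'(1) e(3) e(2)])
  next
    case 4 show thesis by (rule that[OF 4 t'(3) e(2) e'(3) e'(1)])
  next
    case 5 show thesis by (rule that[OF 5 t'(4) e'(3) e(1) e'(2)])
  next
    case 6 show thesis by (rule that[OF 6 t'(5) e'(2) e'(1) e'(3)])
  qed
qed

text \<open>The spokes cut the polygon into triangles and the quadrilateral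
  \<open>i, P, P + j, N\<close>. Hence the only other diagonals that no spoke crosses are
  \<open>{P, N}\<close> and \<open>{i, P + j}\<close>, which the last two assumptions leave
  out.\<close>

lemma crossed_by_spoke:
  assumes ij: "1 \<le> i" "i \<le> a" "1 \<le> j" "j \<le> b"
    and xy: "x < y" "{x, y} \<in> diagonals (a + b + 2)" "\<not> spoke a b i j x y"
    and "\<not> (x = a + 1 \<and> y = a + b + 2)" "\<not> (x = i \<and> y = a + 1 + j)"
  shows "\<exists>u v. u < v \<and> {u, v} \<in> diagonals (a + b + 2) \<and> spoke a b i j u v \<and>
    (x < u \<and> u < y \<and> y < v \<or> u < x \<and> x < v \<and> v < y)"
proof -
  define P where "P = a + 1"
  define N where "N = a + b + 2"
  have bounds: "1 \<le> x" "Suc (Suc x) \<le> y" "y \<le> N" "\<not> (x = 1 \<and> y = N)"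
    using xy by (auto simp: diagonals_iff N_def)
  have wit: ?thesis if "1 \<le> u" "Suc (Suc u) \<le> v" "v \<le> N" "\<not> (u = 1 \<and> v = N)" "spoke a b i j u v"
    "x < u \<and> u < y \<and> y < v \<or> u < x \<and> x < v \<and> v < y" for u v
    using that by (intro exI[of _ u] exI[of _ v]) (auto simp: diagonals_iff N_def)
  have sp: "spoke a b i j u v \<longleftrightarrow> v = P \<and> i \<le> u \<or> u = P \<and> v \<le> P + j \<or>
     v = N \<and> (u \<le> i \<or> P + j \<le> u)" for u v
    by (simp add: spoke_def P_def N_def)
  have PN: "i < P" "P + j < N" "P + b + 1 = N" "a + 1 = P"
    using ij by (auto simp: P_def N_def)
  note facts = ij(1,3) bounds PN assms(7-)[folded N_def, unfolded PN(4) sp]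
  \<comment> \<open>In the first and the last case the diagonal stays within one red arc, and a
    spoke at \<open>Suc x\<close> crosses it. In all others a side of the quadrilateral
    does.\<close>
  consider "y < P" | "y = P" | "x < P" "y = N" | "x < P" "P < y" "y < N" | "x = P" | "P < x" "y = N"
    | "P < x" "y < N"
    using bounds by linarith
  then show ?thesis
  proof cases
    case 1
    show ?thesis
      using 1 facts
      by (cases "Suc x \<le> i"; intro wit[of "Suc x" "if Suc x \<le> i then N else P"]) (auto simp: sp)
  next
    case 2
    then show ?thesis using facts by (intro wit[of i N]) (auto simp: sp)
  next
    case 3
    then show ?thesis using facts by (intro wit[of i P]) (auto simp: sp)
  next
    case 4
    consider "x < i" | "i < x" | "x = i" "y < P + j" | "x = i" "P + j < y"
      using assms(9) PN(4) by (cases x i rule: linorder_cases; cases y "P + j" rule: linorder_cases) auto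
    then show ?thesis
    proof cases
      case 1
      then show ?thesis using 4 facts by (intro wit[of i N]) (auto simp: sp)
    next
      case 2
      then show ?thesis using 4 facts by (intro wit[of i P]) (auto simp: sp)
    next
      case 3
      then show ?thesis using 4 facts by (intro wit[of P "P + j"]) (auto simp: sp)
    next
      case this: 4
      then show ?thesis using facts \<open>y < N\<close> by (intro wit[of "P + j" N]) (auto simp: sp)
    qed
  next
    case 5
    then show ?thesis using facts by (intro wit[of "P + j" N]) (auto simp: sp)
  next
    case 6
    then show ?thesis using facts by (intro wit[of P "P + j"]) (auto simp: sp)
  next
    case 7
    show ?thesis
    proof (cases "Suc x \<le> P + j")
      case True
      then show ?thesis using 7 facts by (intro wit[of P "Suc x"]) (auto simp: sp)
    next
      case False
      then show ?thesis using 7 facts by (intro wit[of "Suc x" N]) (auto simp: sp)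
    qed
  qed
qed

section \<open>The two families consist of colorful triangulations\<close>

lemma grid_tri_in_triangulations:
  assumes "1 \<le> i" "i \<le> a" "1 \<le> j" "j \<le> b"
  shows "grid_tri a b i j \<in> triangulations (a + b + 2)"
proof (rule triangulationsI[OF grid_tri_subset])
  fix x y u v
  assume "{x, y} \<in> grid_tri a b i j" "{u, v} \<in> grid_tri a b i j" "x < u" "u < y" "y < v"
  then show False
    using assms by (simp add: tri_simps) linarith
next
  fix x y
  assume xy: "x < y" "{x, y} \<in> diagonals (a + b + 2)" "{x, y} \<notin> grid_tri a b i j"
  show "\<exists>u v. {u, v} \<in> grid_tri a b i j \<and> (x < u \<and> u < y \<and> y < v \<or> u < x \<and> x < v \<and> v < y)"
  \<comment> \<open>The one missing diagonal that no spoke crosses is crossed by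
    \<open>{P, N}\<close>.\<close>
  proof (cases "x = i \<and> y = a + 1 + j")
    case True
    then show ?thesis
      using assms by (intro exI[of _ "a + 1"] exI[of _ "a + b + 2"]) (auto simp: tri_simps)
  next
    case False
    with xy have "\<not> spoke a b i j x y" "\<not> (x = a + 1 \<and> y = a + b + 2)" "\<not> (x = i \<and> y = a + 1 + j)"
      by (simp_all add: grid_tri_iff)
    from crossed_by_spoke[OF assms xy(1,2) this] show ?thesis
      by (elim exE conjE, intro exI conjI) (simp_all add: grid_tri_iff)
  qed
qed

lemma pendant_tri_in_triangulations:
  assumes "1 \<le> i" "i \<le> a" "1 \<le> j" "j \<le> b"
  shows "pendant_tri a b i j \<in> triangulations (a + b + 2)"
proof (rule triangulationsI[OF pendant_tri_subset])
  fix x y u v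
  assume "{x, y} \<in> pendant_tri a b i j" "{u, v} \<in> pendant_tri a b i j" "x < u" "u < y" "y < v"
  then show False
    using assms by (simp add: tri_simps) linarith
next
  fix x y
  assume xy: "x < y" "{x, y} \<in> diagonals (a + b + 2)" "{x, y} \<notin> pendant_tri a b i j"
  show "\<exists>u v. {u, v} \<in> pendant_tri a b i j \<and> (x < u \<and> u < y \<and> y < v \<or> u < x \<and> x < v \<and> v < y)"
  \<comment> \<open>The diagonals of the quadrilateral exchange roles: \<open>{P, N}\<close> is
    missing and \<open>{i, P + j}\<close> crosses it.\<close>
  proof (cases "x = a + 1 \<and> y = a + b + 2")
    case True
    then show ?thesis
      using assms by (intro exI[of _ i] exI[of _ "a + 1 + j"]) (auto simp: tri_simps)
  next
    case False
    with xy have "\<not> spoke a b i j x y" "\<not> (x = a + 1 \<and> y = a + b + 2)" "\<not> (x = i \<and> y = a + 1 + j)"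
      by (simp_all add: pendant_tri_iff)
    from crossed_by_spoke[OF assms xy(1,2) this] show ?thesis
      by (elim exE conjE, intro exI conjI) (simp_all add: pendant_tri_iff)
  qed
qed

text \<open>Just two points are blue, so a monochromatic triangle can only be all red. Corners are
  sorted to suit the rules about ordered endpoints.\<close>

lemma colorful_iff:
  assumes "triangulation (a + b + 2) T"
  shows "colorful (a + b + 2) (point_color a b) T \<longleftrightarrow>
    (\<forall>x y z. x < y \<and> y < z \<and> {x, y} \<in> polygon_edges (a + b + 2) \<union> T \<and>
      {y, z} \<in> polygon_edges (a + b + 2) \<union> T \<and> {x, z} \<in> polygon_edges (a + b + 2) \<union> T
      \<longrightarrow> {x, y, z} \<inter> {a + 1, a + b + 2} \<noteq> {})" (is "?L \<longleftrightarrow> ?R")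
proof -
  interpret triangulation "a + b + 2" T by fact
  let ?E = "polygon_edges (a + b + 2) \<union> T"
  have mono: "(\<exists>c. \<forall>w\<in>{x, y, z}. point_color a b w = c) \<longleftrightarrow> {x, y, z} \<inter> {a + 1, a + b + 2} = {}"
    if "x < y" "y < z" "{x, z} \<in> ?E" for x y z
  proof -
    have blue: "point_color a b w = Blue \<longleftrightarrow> w = a + 1 \<or> w = a + b + 2" if "w \<in> {x, y, z}" for w
      using \<open>x < y\<close> \<open>y < z\<close> edge_bounds[OF \<open>{x, z} \<in> ?E\<close>] that
      by (intro point_color_eq_Blue_iff) auto
    have "\<not> (\<forall>w\<in>{x, y, z}. point_color a b w = Blue)"
      using \<open>x < y\<close> \<open>y < z\<close> blue[of x] blue[of y] blue[of z] by auto
    moreover have "(\<forall>w\<in>{x, y, z}. point_color a b w \<noteq> Blue) \<longleftrightarrow> {x, y, z} \<inter> {a + 1, a + b + 2} = {}"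
      using blue by blast
    ultimately show ?thesis
      unfolding ex_all_eq_color_iff by blast
  qed
  show ?thesis
  proof
    assume L: ?L
    show ?R
    proof (intro allI impI, elim conjE)
      fix x y z assume *: "x < y" "y < z" "{x, y} \<in> ?E" "{y, z} \<in> ?E" "{x, z} \<in> ?E"
      then have "{x, y, z} \<in> triangles (a + b + 2) T"
        unfolding triangles_def by (intro CollectI exI[of _ x] exI[of _ y] exI[of _ z]) simp
      with L have "\<not> (\<exists>c. \<forall>w\<in>{x, y, z}. point_color a b w = c)"
        unfolding colorful_def by (rule bspec)
      then show "{x, y, z} \<inter> {a + 1, a + b + 2} \<noteq> {}"
        unfolding mono[OF *(1,2,5)] .
    qed
  next
    assume R: ?R
    show ?L
      unfolding colorful_def
    proof
      fix t assume "t \<in> triangles (a + b + 2) T"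
      then show "\<not> (\<exists>c. \<forall>x\<in>t. point_color a b x = c)"
      proof (rule ordered_triangleE)
        fix x y z assume *: "x < y" "y < z" "t = {x, y, z}" "{x, y} \<in> ?E" "{y, z} \<in> ?E" "{x, z} \<in> ?E"
        then have "{x, y, z} \<inter> {a + 1, a + b + 2} \<noteq> {}"
          using R by blast
        then show ?thesis
          unfolding *(3) mono[OF *(1,2,6)] .
      qed
    qed
  qed
qed

text \<open>The only edges without a blue end are steps \<open>{x, Suc x}\<close> along an arc, but
  the longest side of a triangle spans at least two steps.\<close>

lemma colorful_grid_tri:
  assumes "1 \<le> i" "i \<le> a" "1 \<le> j" "j \<le> b"
  shows "colorful (a + b + 2) (point_color a b) (grid_tri a b i j)"
proof -
  let ?E = "polygon_edges (a + b + 2) \<union> grid_tri a b i j"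
  have *: "triangulation (a + b + 2) (grid_tri a b i j)"
    using grid_tri_in_triangulations[OF assms] by unfold_locales auto
  have red_edge: "y = Suc x"
    if "x < y" "{x, y} \<in> ?E" "x \<noteq> a + 1" "x \<noteq> a + b + 2" "y \<noteq> a + 1" "y \<noteq> a + b + 2" for x y
    using that by (auto simp: tri_simps)
  show ?thesis
    unfolding colorful_iff[OF *]
  proof (intro allI impI notI, elim conjE)
    fix x y z
    assume "x < y" "y < z" "{x, y} \<in> ?E" "{y, z} \<in> ?E" "{x, z} \<in> ?E"
      "{x, y, z} \<inter> {a + 1, a + b + 2} = {}"
    then show False
      using red_edge[of x y] red_edge[of y z] red_edge[of x z] assms by auto
  qed
qed

text \<open>Besides steps along an arc, only \<open>{i, P + j}\<close> avoids blue points. As the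
  longest side of a red triangle it would need \<open>P + j = i + 2\<close>, and since
  \<open>i < P < P + j\<close> the middle corner would be the blue \<open>P\<close>.\<close>

lemma colorful_pendant_tri:
  assumes "1 \<le> i" "i \<le> a" "1 \<le> j" "j \<le> b"
  shows "colorful (a + b + 2) (point_color a b) (pendant_tri a b i j)"
proof -
  let ?E = "polygon_edges (a + b + 2) \<union> pendant_tri a b i j"
  have *: "triangulation (a + b + 2) (pendant_tri a b i j)"
    using pendant_tri_in_triangulations[OF assms] by unfold_locales auto
  have red_edge: "y = Suc x \<or> x = i \<and> y = a + 1 + j"
    if "x < y" "{x, y} \<in> ?E" "x \<noteq> a + 1" "x \<noteq> a + b + 2" "y \<noteq> a + 1" "y \<noteq> a + b + 2" for x y
    using that by (auto simp: tri_simps)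
  show ?thesis
    unfolding colorful_iff[OF *]
  proof (intro allI impI notI, elim conjE)
    fix x y z
    assume "x < y" "y < z" "{x, y} \<in> ?E" "{y, z} \<in> ?E" "{x, z} \<in> ?E"
      "{x, y, z} \<inter> {a + 1, a + b + 2} = {}"
    then show False
      using red_edge[of x y] red_edge[of y z] red_edge[of x z] assms by auto
  qed
qed

text \<open>It suffices to find the four sides of a quadrilateral \<open>i, P, P + j, N\<close>
  among the edges (\<open>key\<close>): together with \<open>red\<close> they confine all diagonals
  to one of the two families, and maximality turns inclusion into equality.\<close>

lemma colorful_triangulation_cases:
  assumes ab: "1 \<le> a" "1 \<le> b"
    and T: "T \<in> triangulations (a + b + 2)" "colorful (a + b + 2) (point_color a b) T"
  shows "\<exists>i\<in>{1..a}. \<exists>j\<in>{1..b}. T = grid_tri a b i j \<or> T = pendant_tri a b i j"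
proof -
  define P where "P = a + 1"
  define N where "N = a + b + 2"
  let ?E = "polygon_edges N \<union> T"
  interpret triangulation N T
    using T by unfold_locales (auto simp: N_def)
  have PN: "1 < P" "Suc P < N" "a + 1 = P" "a + b + 2 = N" "P + b + 1 = N"
    using ab by (auto simp: P_def N_def)
  have bicolored: "{x, y, z} \<inter> {P, N} \<noteq> {}"
    if "x < y" "y < z" "{x, y} \<in> ?E" "{y, z} \<in> ?E" "{x, z} \<in> ?E" for x y z
    using that T(2) colorful_iff[of a b T, unfolded PN] triangulation_axioms unfolding PN by simp
  \<comment> \<open>The inner apex over such a diagonal lies on the same arc, which gives an all-red
    triangle.\<close>
  have red: False if xy: "{x, y} \<in> T" "Suc x < y" "y < P \<or> P < x \<and> y < N" for x y
  proof -
    obtain z where "x < z" "z < y" "{x, z} \<in> ?E" "{z, y} \<in> ?E"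
      by (rule inner_apex[of x y]) (use xy in auto)
    then show False
      using bicolored[of x z y] xy PN by auto
  qed
  have key: ?thesis
    if ij: "1 \<le> i" "i \<le> a" "1 \<le> j" "j \<le> b"
      and E: "{i, P} \<in> ?E" "{i, N} \<in> ?E" "{P, P + j} \<in> ?E" "{P + j, N} \<in> ?E" for i j
  proof -
    have iN: "i < P" "P + j < N" using ij PN by auto
    have form: "spoke a b i j x y \<or> x = P \<and> y = N \<or> x = i \<and> y = P + j"
      if xy: "x < y" "{x, y} \<in> T" for x y
    proof -
      have nc: "\<not> (x < u \<and> u < y \<and> y < v)" "\<not> (u < x \<and> x < v \<and> v < y)" if "{u, v} \<in> ?E" for u v
        using that xy edges_noncrossing[of x y u v] edges_noncrossing[of u v x y] by auto
      have bounds: "1 \<le> x" "y \<le> N" using edge_bounds[of x y] xy by auto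
      have long: "Suc x < y"
        using xy subset_diagonals two_le_N by (auto simp: diagonals_iff dest!: subsetD)
      note nc' = nc[OF E(1)] nc[OF E(2)] nc[OF E(3)] nc[OF E(4)]
      have sp: "spoke a b i j x y \<longleftrightarrow> y = P \<and> i \<le> x \<or> x = P \<and> y \<le> P + j \<or>
        y = N \<and> (x \<le> i \<or> P + j \<le> x)"
        by (simp add: spoke_def P_def N_def)
      consider "y < P" | "y = P" | "x < P" "P < y" "y < N" | "x < P" "y = N" | "x = P" "y < N"
        | "x = P" "y = N" | "P < x" "y < N" | "P < x" "y = N"
        using bounds by linarith
      then show ?thesis
      proof cases
        case 1 then show ?thesis using red[of x y] xy long by simp
      next
        case 2 then show ?thesis unfolding sp using nc'(3,4) PN iN by auto
      next
        case 3
        then have "x = i" using nc'(1-4) iN by auto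
        moreover have "y = P + j" using nc'(5-8) iN 3 by auto
        ultimately show ?thesis by simp
      next
        case 4 then show ?thesis unfolding sp using nc'(1,2) PN iN by auto
      next
        case 5 then show ?thesis unfolding sp using nc'(7,8) PN iN ij(3) by auto
      next
        case 6 then show ?thesis by simp
      next
        case 7 then show ?thesis using red[of x y] xy long by simp
      next
        case 8 then show ?thesis unfolding sp using nc'(5,6) PN iN ij(3) by auto
      qed
    qed
    \<comment> \<open>\<open>form\<close> permits both diagonals of the quadrilateral, but they
      cross, so \<open>T\<close> contains at most one of them.\<close>
    have "T = grid_tri a b i j \<or> T = pendant_tri a b i j"
    proof (cases "{P, N} \<in> T")
      case True
      then have "{i, P + j} \<notin> T"
        using edges_noncrossing[of i "P + j" P N] iN ij by auto
      have "T \<subseteq> grid_tri a b i j"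
      proof
        fix d assume d: "d \<in> T"
        then obtain x y where xy: "x < y" "d = {x, y}"
          using subset_diagonals by (meson diagonalsE subsetD)
        then show "d \<in> grid_tri a b i j"
          using form[of x y] d \<open>{i, P + j} \<notin> T\<close> subset_diagonals
          by (auto simp: grid_tri_iff P_def N_def)
      qed
      then show ?thesis
        using maximal grid_tri_in_triangulations[OF ij] by (simp add: N_def)
    next
      case False
      have "T \<subseteq> pendant_tri a b i j"
      proof
        fix d assume d: "d \<in> T"
        then obtain x y where xy: "x < y" "d = {x, y}"
          using subset_diagonals by (meson diagonalsE subsetD)
        then show "d \<in> pendant_tri a b i j"
          using form[of x y] d False subset_diagonals
          by (auto simp: pendant_tri_iff P_def N_def)
      qed
      then show ?thesis
        using maximal pendant_tri_in_triangulations[OF ij] by (simp add: N_def)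
    qed
    then show ?thesis using ij by (intro bexI[of _ i] bexI[of _ j]) auto
  qed
  show ?thesis
  proof (cases "{P, N} \<in> T")
    case True
    let ?K = "{k. k < P \<and> {k, N} \<in> ?E}"
    \<comment> \<open>The last neighbor of \<open>N\<close> on the first arc, counting the side
      \<open>{1, N}\<close>. A member going from strictly between \<open>i\<close> and
      \<open>P\<close> past \<open>P\<close> ends at \<open>N\<close>, against maximality, or
      crosses \<open>{P, N}\<close>.\<close>
    define i where "i = Max ?K"
    have fin: "finite ?K" by simp
    have one: "1 \<in> ?K"
      using PN by (auto simp: polygon_edges_def)
    then have i: "i \<in> ?K" unfolding i_def using fin by (metis (no_types) Max_in empty_iff)
    have i_max: "k \<le> i" if "k \<in> ?K" for k
      unfolding i_def using fin that by (rule Max_ge)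
    have "1 \<le> i" using i_max[OF one] .
    have "{i, P} \<in> ?E"
    proof (rule edge_if_uncrossed)
      show "i < P" "1 \<le> i" "P \<le> N" using i \<open>1 \<le> i\<close> PN by auto
    next
      fix u v assume "{u, v} \<in> T" "1 \<le> u" "u < i" "i < v" "v < P"
      then show False using red[of u v] by simp
    next
      fix u v assume uv: "{u, v} \<in> T" "v \<le> N" "i < u" "u < P" "P < v"
      then have "v \<noteq> N" using i_max[of u] by auto
      then show False using edges_noncrossing[of u v P N] uv True by auto
    qed
    \<comment> \<open>The apex over \<open>{P, N}\<close> on the second arc serves as
      \<open>P + j\<close>.\<close>
    moreover obtain z where z: "P < z" "z < N" "{P, z} \<in> ?E" "{z, N} \<in> ?E"
      by (rule inner_apex[of P N]) (use True PN in auto)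
    ultimately show ?thesis
      using key[of i "z - P"] i \<open>1 \<le> i\<close> PN by auto
  next
    case False
    let ?X = "\<lambda>x. x < P \<and> (\<exists>y. P < y \<and> y < N \<and> {x, y} \<in> T)"
    have "\<exists>x. ?X x"
    proof (rule ccontr)
      assume no: "\<nexists>x. ?X x"
      have "{P, N} \<in> ?E"
      proof (rule edge_if_uncrossed)
        show "P < N" "1 \<le> P" "N \<le> N" using PN by auto
      qed (use no in auto)
      then show False
        using False PN by (auto simp: polygon_edges_iff)
    qed
    \<comment> \<open>Among the red diagonals crossing \<open>{P, N}\<close> take an outermost one:
      least \<open>x\<close>, then greatest \<open>y\<close>. Nothing separates it from
      \<open>N\<close>, so \<open>{x, N}\<close> and \<open>{y, N}\<close> are edges, while its
      inner apex must be blue and hence is \<open>P\<close>.\<close>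
    define x where "x = (LEAST x. ?X x)"
    have x: "?X x"
      unfolding x_def using \<open>\<exists>x. ?X x\<close> by (rule LeastI_ex)
    have x_min: "x \<le> k" if "?X k" for k
      unfolding x_def using that by (rule Least_le)
    let ?Y = "{y. P < y \<and> y < N \<and> {x, y} \<in> T}"
    define y where "y = Max ?Y"
    have fin: "finite ?Y" by simp
    have y: "y \<in> ?Y" unfolding y_def using fin x by (intro Max_in) auto
    have y_max: "k \<le> y" if "k \<in> ?Y" for k
      unfolding y_def using fin that by (rule Max_ge)
    have xy: "x < P" "P < y" "y < N" "{x, y} \<in> T" using x y by auto
    have "1 \<le> x" using edge_bounds[of x y] xy by auto
    obtain z where z: "x < z" "z < y" "{x, z} \<in> ?E" "{z, y} \<in> ?E"
      by (rule inner_apex[of x y]) (use xy in auto)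
    then have "z = P"
      using bicolored[of x z y] xy by auto
    have "{x, N} \<in> ?E"
    proof (rule edge_if_uncrossed)
      show "x < N" "1 \<le> x" "N \<le> N" using xy \<open>1 \<le> x\<close> by auto
    next
      fix u v assume uv: "{u, v} \<in> T" "1 \<le> u" "u < x" "x < v" "v < N"
      consider "v < P" | "v = P" | "P < v" by linarith
      then show False
      proof cases
        case 1 then show False using red[of u v] uv by simp
      next
        case 2 then show False using edges_noncrossing[of u v x y] uv xy by auto
      next
        case 3 then show False using x_min[of u] uv xy by auto
      qed
    qed auto
    moreover have "{y, N} \<in> ?E"
    proof (rule edge_if_uncrossed)
      show "y < N" "1 \<le> y" "N \<le> N" using xy by auto
    next
      fix u v assume uv: "{u, v} \<in> T" "1 \<le> u" "u < y" "y < v" "v < N"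
      consider "P < u" | "x < u" "u \<le> P" | "u = x" | "u < x" by linarith
      then show False
      proof cases
        case 1 then show False using red[of u v] uv by simp
      next
        case 2 then show False using edges_noncrossing[of x y u v] uv xy by auto
      next
        case 3 then show False using y_max[of v] uv xy by auto
      next
        case 4
        have "?X u" using 4 uv xy by (intro conjI exI[of _ v]) auto
        then show False using x_min[of u] 4 by simp
      qed
    qed auto
    ultimately show ?thesis
      using key[of x "y - P"] \<open>1 \<le> x\<close> xy z \<open>z = P\<close> PN by auto
  qed
qed

section \<open>Flips between colorful triangulations\<close>

text \<open>The flip takes place in the quadrilateral \<open>i < Suc i < P < N\<close>, which has
  \<open>{P, N}\<close> as a side, and trades the spoke \<open>{i, P}\<close> for
  \<open>{Suc i, N}\<close>.\<close>

lemma flip_grid_tri_left: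
  assumes "1 \<le> i" "Suc i \<le> a" "1 \<le> j" "j \<le> b"
  shows "flip (a + b + 2) (grid_tri a b i j) (grid_tri a b (Suc i) j)"
    and "flip (a + b + 2) (grid_tri a b (Suc i) j) (grid_tri a b i j)"
proof -
  have eq: "grid_tri a b (Suc i) j = insert {Suc i, a + b + 2} (grid_tri a b i j - {{i, a + 1}})"
    by (rule diagonal_sets_eqI[OF grid_tri_subset])
      (use assms grid_tri_subset[of a b i j] in
        \<open>auto simp: tri_simps doubleton_eq_ordered_iff doubleton_eq_iff\<close>)
  show "flip (a + b + 2) (grid_tri a b i j) (grid_tri a b (Suc i) j)"
    and "flip (a + b + 2) (grid_tri a b (Suc i) j) (grid_tri a b i j)"
    by (rule flip_quadrilateral[OF _ _ _ _ _ _ _ _ _ eq]; use assms in \<open>auto simp: tri_simps\<close>)+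
qed

lemma flip_grid_tri_right:
  assumes "1 \<le> i" "i \<le> a" "1 \<le> j" "Suc j \<le> b"
  shows "flip (a + b + 2) (grid_tri a b i j) (grid_tri a b i (Suc j))"
    and "flip (a + b + 2) (grid_tri a b i (Suc j)) (grid_tri a b i j)"
proof -
  \<comment> \<open>\<open>flip_quadrilateral\<close> removes the diagonal at the smallest corner.
    In \<open>P < P + j < Suc (P + j) < N\<close> this is the spoke \<open>{P, Suc (P + j)}\<close>
    of the pair \<open>(i, Suc j)\<close>, so the equation runs from \<open>Suc j\<close> to
    \<open>j\<close>.\<close>
  have eq: "grid_tri a b i j =
      insert {a + 1 + j, a + b + 2} (grid_tri a b i (Suc j) - {{a + 1, Suc (a + 1 + j)}})"
    by (rule diagonal_sets_eqI[OF grid_tri_subset])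
      (use assms grid_tri_subset[of a b i "Suc j"] in
        \<open>auto simp: tri_simps doubleton_eq_ordered_iff doubleton_eq_iff\<close>)
  show "flip (a + b + 2) (grid_tri a b i j) (grid_tri a b i (Suc j))"
    and "flip (a + b + 2) (grid_tri a b i (Suc j)) (grid_tri a b i j)"
    by (rule flip_quadrilateral[OF _ _ _ _ _ _ _ _ _ eq]; use assms in \<open>auto simp: tri_simps\<close>)+
qed

lemma flip_grid_pendant_tri:
  assumes "1 \<le> i" "i \<le> a" "1 \<le> j" "j \<le> b"
  shows "flip (a + b + 2) (grid_tri a b i j) (pendant_tri a b i j)"
    and "flip (a + b + 2) (pendant_tri a b i j) (grid_tri a b i j)"
proof -
  \<comment> \<open>In \<open>i < P < P + j < N\<close> the diagonal at the smallest corner is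
    \<open>{i, P + j}\<close>, so the pendant triangulation is the starting point.\<close>
  have eq: "grid_tri a b i j =
      insert {a + 1, a + b + 2} (pendant_tri a b i j - {{i, a + 1 + j}})"
    by (rule diagonal_sets_eqI[OF grid_tri_subset])
      (use assms pendant_tri_subset[of a b i j] in
        \<open>auto simp: tri_simps doubleton_eq_ordered_iff doubleton_eq_iff\<close>)
  show "flip (a + b + 2) (grid_tri a b i j) (pendant_tri a b i j)"
    and "flip (a + b + 2) (pendant_tri a b i j) (grid_tri a b i j)"
    by (rule flip_quadrilateral[OF _ _ _ _ _ _ _ _ _ eq]; use assms in \<open>auto simp: tri_simps\<close>)+
qed

section \<open>Excluding flips through lost rays\<close>

definition ray :: "nat \<Rightarrow> nat \<Rightarrow> nat \<Rightarrow> nat \<Rightarrow> bool" where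
  "ray a b x y \<longleftrightarrow> x < y \<and> (y = a + 1 \<or> x = a + 1 \<and> y \<noteq> a + b + 2 \<or> x \<noteq> a + 1 \<and> y = a + b + 2)"

text \<open>Rays are the segments with exactly one blue end. They avoid both \<open>{P, N}\<close>
  and \<open>{i, P + j}\<close>, so the two families agree on them and only \<open>(i, j)\<close>
  matters.\<close>

lemma ray_mem_iff:
  assumes "1 \<le> i" "i \<le> a" "1 \<le> j" "j \<le> b"
    and "T \<in> {grid_tri a b i j, pendant_tri a b i j}" "ray a b x y"
  shows "{x, y} \<in> T \<longleftrightarrow> {x, y} \<in> diagonals (a + b + 2) \<and> spoke a b i j x y"
proof -
  have "x < y" "\<not> (x = a + 1 \<and> y = a + b + 2)" "\<not> (x = i \<and> y = a + 1 + j)"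
    using assms by (auto simp: ray_def)
  then show ?thesis
    using assms(5) by (auto simp: grid_tri_iff pendant_tri_iff)
qed

text \<open>The ray is a side of the quadrilateral \<open>i, P, P + j, N\<close> of
  \<open>T\<close>, chosen by which coordinate changes and in which direction.\<close>

lemma lost_ray:
  assumes ij: "1 \<le> i" "i \<le> a" "1 \<le> j" "j \<le> b" and ij': "1 \<le> i'" "i' \<le> a" "1 \<le> j'" "j' \<le> b"
    and T: "T \<in> {grid_tri a b i j, pendant_tri a b i j}"
    and T': "T' \<in> {grid_tri a b i' j', pendant_tri a b i' j'}"
    and ne: "(i, j) \<noteq> (i', j')"
  obtains x y where "ray a b x y" "{x, y} \<in> T" "{x, y} \<notin> T'"
proof -
  note mem = ray_mem_iff[OF ij T] ray_mem_iff[OF ij' T']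
  consider "i < i'" | "i' < i" | "j < j'" | "j' < j"
    using ne by fastforce
  then show thesis
  proof cases
    case 1
    then show thesis
      using assms by (intro that[of i "a + 1"]) (auto simp: mem ray_def diagonals_iff spoke_def)
  next
    case 2
    then show thesis
      using assms by (intro that[of i "a + b + 2"]) (auto simp: mem ray_def diagonals_iff spoke_def)
  next
    case 3
    then show thesis
      using assms by (intro that[of "a + 1 + j" "a + b + 2"]) (auto simp: mem ray_def diagonals_iff spoke_def)
  next
    case 4
    then show thesis
      using assms by (intro that[of "a + 1" "a + 1 + j"]) (auto simp: mem ray_def diagonals_iff spoke_def)
  qed
qed

text \<open>A flip loses a single diagonal, whereas passing from \<open>(i, j)\<close> to
  \<open>(i', j')\<close> loses one ray per unit of grid distance.\<close>

lemma flip_imp_adjacent: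
  assumes ij: "1 \<le> i" "i \<le> a" "1 \<le> j" "j \<le> b" and ij': "1 \<le> i'" "i' \<le> a" "1 \<le> j'" "j' \<le> b"
    and flip: "flip (a + b + 2) (grid_tri a b i j) (grid_tri a b i' j')"
  shows "i = i' \<and> (j' = Suc j \<or> j = Suc j') \<or> j = j' \<and> (i' = Suc i \<or> i = Suc i')"
proof -
  let ?P = "a + 1" and ?N = "a + b + 2"
  \<comment> \<open>The lost rays for an increase or a decrease of \<open>i\<close> and of
    \<open>j\<close>. The half-open ranges keep polygon sides out.\<close>
  define A where "A = {(k, ?P) | k. i \<le> k \<and> k < i'} \<union> {(k, ?N) | k. i' < k \<and> k \<le> i} \<union>
      {(?P + k, ?N) | k. j \<le> k \<and> k < j'} \<union> {(?P, ?P + k) | k. j' < k \<and> k \<le> j}"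
  have lost: "x < y" "{x, y} \<in> grid_tri a b i j" "{x, y} \<notin> grid_tri a b i' j'"
    if "(x, y) \<in> A" for x y
  proof -
    show "x < y"
      using that ij ij' by (auto simp: A_def)
    moreover have "ray a b x y"
      using that ij ij' by (auto simp: A_def ray_def)
    moreover have "spoke a b i j x y" "\<not> spoke a b i' j' x y" "{x, y} \<in> diagonals ?N"
      using that ij ij' by (auto simp: A_def spoke_def diagonals_iff)
    ultimately show "{x, y} \<in> grid_tri a b i j" "{x, y} \<notin> grid_tri a b i' j'"
      using ray_mem_iff[OF ij, of "grid_tri a b i j" x y] ray_mem_iff[OF ij', of "grid_tri a b i' j'" x y]
      by auto
  qed
  have single: "(x, y) = (u, v)" if "(x, y) \<in> A" "(u, v) \<in> A" for x y u v
    using flip_diff(2)[OF flip, of "{x, y}" "{u, v}"] lost[OF that(1)] lost[OF that(2)]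
    by (simp add: doubleton_eq_ordered_iff)
  have ne: "(i, j) \<noteq> (i', j')"
    using flip_diff(1)[OF flip] by auto
  have "\<not> Suc i < i'"
    using single[of i ?P "Suc i" ?P] by (auto simp: A_def)
  moreover have "\<not> Suc i' < i"
    using single[of i ?N "Suc i'" ?N] by (auto simp: A_def)
  moreover have "\<not> Suc j < j'"
    using single[of "?P + j" ?N "?P + Suc j" ?N] by (auto simp: A_def)
  moreover have "\<not> Suc j' < j"
    using single[of ?P "?P + j" ?P "?P + Suc j'"] by (auto simp: A_def)
  moreover have "i = i' \<or> j = j'"
  proof (rule ccontr)
    assume "\<not> ?thesis"
    then consider "i < i'" "j < j'" | "i < i'" "j' < j" | "i' < i" "j < j'" | "i' < i" "j' < j"
      by linarith
    then show False
    proof cases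
      case 1 then show False using single[of i ?P "?P + j" ?N] by (auto simp: A_def)
    next
      case 2 then show False using single[of i ?P ?P "?P + j"] ij by (auto simp: A_def)
    next
      case 3 then show False using single[of i ?N "?P + j" ?N] ij by (auto simp: A_def)
    next
      case 4 then show False using single[of i ?N ?P "?P + j"] ij by (auto simp: A_def)
    qed
  qed
  ultimately show ?thesis using ne by auto
qed

lemma flip_grid_grid_iff:
  assumes "1 \<le> i" "i \<le> a" "1 \<le> j" "j \<le> b" "1 \<le> i'" "i' \<le> a" "1 \<le> j'" "j' \<le> b"
  shows "flip (a + b + 2) (grid_tri a b i j) (grid_tri a b i' j') \<longleftrightarrow>
    i = i' \<and> (j' = Suc j \<or> j = Suc j') \<or> j = j' \<and> (i' = Suc i \<or> i = Suc i')"
  using assms flip_imp_adjacent[OF assms] flip_grid_tri_left[of i a j b] flip_grid_tri_left[of i' a j b]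
    flip_grid_tri_right[of i a j b] flip_grid_tri_right[of i a j' b]
  by auto

text \<open>\<open>{P, N}\<close> is lost in any case. For different pairs a ray is lost as well,
  one diagonal too many for a flip.\<close>

lemma flip_grid_pendant_iff:
  assumes "1 \<le> i" "i \<le> a" "1 \<le> j" "j \<le> b" "1 \<le> i'" "i' \<le> a" "1 \<le> j'" "j' \<le> b"
  shows "flip (a + b + 2) (grid_tri a b i j) (pendant_tri a b i' j') \<longleftrightarrow> i = i' \<and> j = j'"
proof
  assume flip: "flip (a + b + 2) (grid_tri a b i j) (pendant_tri a b i' j')"
  show "i = i' \<and> j = j'"
  proof (rule ccontr)
    assume "\<not> ?thesis"
    then obtain x y where xy: "ray a b x y" "{x, y} \<in> grid_tri a b i j" "{x, y} \<notin> pendant_tri a b i' j'"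
      using lost_ray[OF assms, of "grid_tri a b i j" "pendant_tri a b i' j'"] by auto
    moreover have "{a + 1, a + b + 2} \<in> grid_tri a b i j" "{a + 1, a + b + 2} \<notin> pendant_tri a b i' j'"
      using assms by (auto simp: tri_simps)
    ultimately have "{x, y} = {a + 1, a + b + 2}"
      using flip_diff(2)[OF flip] by blast
    then show False using xy(1) by (auto simp: ray_def doubleton_eq_iff)
  qed
qed (use assms flip_grid_pendant_tri in auto)

text \<open>As soon as the pairs differ, \<open>{i, P + j}\<close> is lost along with a ray,
  whichever family the target belongs to.\<close>

lemma flip_from_pendant:
  assumes "1 \<le> i" "i \<le> a" "1 \<le> j" "j \<le> b" "1 \<le> i'" "i' \<le> a" "1 \<le> j'" "j' \<le> b"
    and flip: "flip (a + b + 2) (pendant_tri a b i j) T'"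
    and T': "T' \<in> {grid_tri a b i' j', pendant_tri a b i' j'}"
  shows "i = i' \<and> j = j'"
proof (rule ccontr)
  assume ne: "\<not> ?thesis"
  then obtain x y where xy: "ray a b x y" "{x, y} \<in> pendant_tri a b i j" "{x, y} \<notin> T'"
    using lost_ray[OF assms(1-8), of "pendant_tri a b i j" T'] T' by auto
  moreover have "{i, a + 1 + j} \<in> pendant_tri a b i j" "{i, a + 1 + j} \<notin> T'"
    using assms ne by (auto simp: tri_simps)
  ultimately have "{x, y} = {i, a + 1 + j}"
    using flip_diff(2)[OF flip] by blast
  then show False using xy(1) assms by (auto simp: ray_def doubleton_eq_iff)
qed

lemma flip_pendant_grid_iff:
  assumes "1 \<le> i" "i \<le> a" "1 \<le> j" "j \<le> b" "1 \<le> i'" "i' \<le> a" "1 \<le> j'" "j' \<le> b"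
  shows "flip (a + b + 2) (pendant_tri a b i j) (grid_tri a b i' j') \<longleftrightarrow> i = i' \<and> j = j'"
  using flip_from_pendant[OF assms] flip_grid_pendant_tri(2)[OF assms(1-4)] by auto

lemma not_flip_pendant_pendant:
  assumes "1 \<le> i" "i \<le> a" "1 \<le> j" "j \<le> b" "1 \<le> i'" "i' \<le> a" "1 \<le> j'" "j' \<le> b"
  shows "\<not> flip (a + b + 2) (pendant_tri a b i j) (pendant_tri a b i' j')"
  using flip_from_pendant[OF assms] flip_diff(1) by blast

section \<open>The flip graph\<close>

lemma digraph_iso_with_projI:
  fixes G :: "('a, 'a \<times> 'a) pre_digraph"
  assumes bij: "bij_betw f (pverts H) (verts G)"
    and ends: "tail G = fst" "head G = snd"
    and wf: "arcs G \<subseteq> verts G \<times> verts G" "parcs H \<subseteq> pverts H \<times> pverts H"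
    and arcs: "\<And>u v. \<lbrakk>u \<in> pverts H; v \<in> pverts H\<rbrakk> \<Longrightarrow> (f u, f v) \<in> arcs G \<longleftrightarrow> (u, v) \<in> parcs H"
  shows "digraph_iso G (with_proj H)"
proof -
  \<comment> \<open>\<open>f\<close> runs from \<open>H\<close> to \<open>G\<close>, but the
    isomorphism must start at \<open>G\<close>; hence the inverse, applied componentwise to
    arcs.\<close>
  define g where "g = the_inv_into (pverts H) f"
  have g: "bij_betw g (verts G) (pverts H)"
    unfolding g_def using bij by (rule bij_betw_the_inv_into)
  have fg: "f (g x) = x" if "x \<in> verts G" for x
    using that bij unfolding g_def by (simp add: bij_betw_def f_the_inv_into_f)
  have gf: "g (f u) = u" if "u \<in> pverts H" for u
    using that bij unfolding g_def by (simp add: bij_betw_def the_inv_into_f_f)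
  define h where "h = \<lparr>iso_verts = g, iso_arcs = map_prod g g, iso_head = snd, iso_tail = fst\<rparr>"
  have inj: "inj_on g (verts G)" using g by (rule bij_betw_imp_inj_on)
  have "inj_on (map_prod g g) (arcs G)"
    using map_prod_inj_on[OF inj inj] wf(1) by (rule inj_on_subset)
  moreover have "wf_digraph G"
    using wf(1) ends by unfold_locales auto
  ultimately have "pre_digraph.digraph_isomorphism G h"
    using inj ends by (simp add: pre_digraph.digraph_isomorphism_def h_def)
  moreover have "map_prod g g ` arcs G = parcs H"
  proof
    show "map_prod g g ` arcs G \<subseteq> parcs H"
    proof
      fix e assume "e \<in> map_prod g g ` arcs G"
      then obtain x y where "(x, y) \<in> arcs G" "e = (g x, g y)" by auto
      moreover from this have "x \<in> verts G" "y \<in> verts G" using wf(1) by auto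
      ultimately show "e \<in> parcs H"
        using arcs[of "g x" "g y"] g fg by (auto simp: bij_betw_def)
    qed
    show "parcs H \<subseteq> map_prod g g ` arcs G"
    proof
      fix e assume e: "e \<in> parcs H"
      obtain u v where uv: "e = (u, v)" by (cases e)
      then have "u \<in> pverts H" "v \<in> pverts H" using e wf(2) by auto
      then show "e \<in> map_prod g g ` arcs G"
        using arcs[of u v] e uv gf by (intro image_eqI[of _ _ "(f u, f v)"]) auto
    qed
  qed
  then have "with_proj H = app_iso h G"
    using g by (simp add: app_iso_def with_proj_def h_def bij_betw_def)
  ultimately show ?thesis
    unfolding digraph_iso_def by blast
qed

text \<open>An inner vertex of a path has a predecessor and a successor, which differ because no
  vertex repeats; \<open>leaf\<close> would make them equal.\<close>

lemma (in wf_digraph) leaf_is_end_of_apath: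
  assumes p: "apath u p v" and x: "x \<in> set (awalk_verts u p)"
    and leaf: "\<And>e e'. \<lbrakk>e \<in> arcs G; e' \<in> arcs G; head G e = x; tail G e' = x\<rbrakk> \<Longrightarrow> tail G e = head G e'"
  shows "x = u \<or> x = v"
proof (rule ccontr)
  assume ends: "\<not> (x = u \<or> x = v)"
  obtain xs ys where split: "awalk_verts u p = xs @ x # ys"
    using x by (meson split_list)
  have "cas u p v" "set p \<subseteq> arcs G"
    using p by (auto simp: apath_def awalk_def)
  then obtain q r where qr: "cas u q x" "cas x r v" "p = q @ r"
      "awalk_verts u q = xs @ [x]" "awalk_verts x r = x # ys"
    using awalk_decomp_verts[OF _ split] by metis
  obtain q' e where q: "q = q' @ [e]"
    using qr(1) ends by (cases q rule: rev_cases) auto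
  obtain e' r' where r: "r = e' # r'"
    using qr(2) ends by (cases r) auto
  have "xs = map (tail G) q' @ [tail G e]" "head G e = x"
    using qr(4) by (auto simp: q awalk_verts_conv)
  moreover have "tail G e' = x" "ys = awalk_verts (head G e') r'"
    using qr(5) by (auto simp: r)
  moreover have "head G e' \<in> set (awalk_verts (head G e') r')"
    using qr(2) by (cases r') (auto simp: r)
  moreover have "tail G e = head G e'"
    using leaf[of e e'] \<open>set p \<subseteq> arcs G\<close> calculation by (simp add: qr(3) q r)
  \<comment> \<open>The predecessor lies in \<open>xs\<close> and the successor in
    \<open>ys\<close>, although the path has distinct vertices.\<close>
  ultimately have "tail G e \<in> set xs \<inter> set ys" by simp
  then show False
    using p split by (auto simp: apath_def)
qed

lemma (in wf_digraph) card_leaves_le_2: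
  assumes "has_hamilton_path G" "L \<subseteq> verts G"
    and leaf: "\<And>x e e'. \<lbrakk>x \<in> L; e \<in> arcs G; e' \<in> arcs G; head G e = x; tail G e' = x\<rbrakk>
      \<Longrightarrow> tail G e = head G e'"
  shows "card L \<le> 2"
proof -
  obtain u p v where "apath u p v" "set (awalk_verts u p) = verts G"
    using assms(1) unfolding has_hamilton_path_def by blast
  then have "L \<subseteq> {u, v}"
    using leaf_is_end_of_apath[of u p v] assms(2) leaf by blast
  then have "card L \<le> card {u, v}"
    by (intro card_mono) auto
  also have "\<dots> \<le> 2"
    by (simp add: card_insert_if)
  finally show ?thesis .
qed

section \<open>Labelling the flip graph by the grid with pendants\<close>

definition node_tri :: "nat \<Rightarrow> nat \<Rightarrow> nat \<times> nat + nat \<times> nat \<Rightarrow> nat set set" where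
  "node_tri a b = case_sum (\<lambda>(i, j). grid_tri a b i j) (\<lambda>(i, j). pendant_tri a b i j)"

lemma node_tri_simps [simp]:
  "node_tri a b (Inl (i, j)) = grid_tri a b i j"
  "node_tri a b (Inr (i, j)) = pendant_tri a b i j"
  by (simp_all add: node_tri_def)

lemma pverts_attach_pendants_grid:
  "pverts (attach_pendants (grid_graph a b)) = Inl ` ({1..a} \<times> {1..b}) \<union> Inr ` ({1..a} \<times> {1..b})"
  by (simp add: attach_pendants_def grid_graph_def)

text \<open>A lost ray separates different pairs. For equal pairs, a flip leads from the grid
  triangulation to the pendant one, so they differ.\<close>

lemma inj_on_node_tri: "inj_on (node_tri a b) (pverts (attach_pendants (grid_graph a b)))"
proof (rule inj_onI)
  fix u v
  assume u: "u \<in> pverts (attach_pendants (grid_graph a b))"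
    and v: "v \<in> pverts (attach_pendants (grid_graph a b))"
    and eq: "node_tri a b u = node_tri a b v"
  obtain i j where ij: "1 \<le> i" "i \<le> a" "1 \<le> j" "j \<le> b" "u = Inl (i, j) \<or> u = Inr (i, j)"
    using u by (auto simp: pverts_attach_pendants_grid)
  obtain i' j' where ij': "1 \<le> i'" "i' \<le> a" "1 \<le> j'" "j' \<le> b" "v = Inl (i', j') \<or> v = Inr (i', j')"
    using v by (auto simp: pverts_attach_pendants_grid)
  have mem: "node_tri a b u \<in> {grid_tri a b i j, pendant_tri a b i j}"
    "node_tri a b v \<in> {grid_tri a b i' j', pendant_tri a b i' j'}"
    using ij(5) ij'(5) by auto
  have "(i, j) = (i', j')"
    using lost_ray[OF ij(1-4) ij'(1-4) mem] eq by metis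
  moreover have "grid_tri a b i j \<noteq> pendant_tri a b i j"
    using flip_diff(1)[OF flip_grid_pendant_tri(1)[OF ij(1-4)]] .
  ultimately show "u = v"
    using ij(5) ij'(5) eq by auto
qed

lemma verts_colorful_flip_graph:
  assumes "1 \<le> a" "1 \<le> b"
  shows "verts (colorful_flip_graph a b) = node_tri a b ` pverts (attach_pendants (grid_graph a b))"
proof -
  have "verts (colorful_flip_graph a b) =
      {T \<in> triangulations (a + b + 2). colorful (a + b + 2) (point_color a b) T}" (is "_ = ?V")
    by (simp add: colorful_flip_graph_def)
  also have "?V = node_tri a b ` pverts (attach_pendants (grid_graph a b))"
  proof
    show "?V \<subseteq> node_tri a b ` pverts (attach_pendants (grid_graph a b))"
    proof
      fix T assume "T \<in> ?V"
      then obtain i j where ij: "i \<in> {1..a}" "j \<in> {1..b}"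
          and T: "T = node_tri a b (Inl (i, j)) \<or> T = node_tri a b (Inr (i, j))"
        using colorful_triangulation_cases[OF assms, of T] by auto
      then show "T \<in> node_tri a b ` pverts (attach_pendants (grid_graph a b))"
        unfolding pverts_attach_pendants_grid by blast
    qed
    show "node_tri a b ` pverts (attach_pendants (grid_graph a b)) \<subseteq> ?V"
      using grid_tri_in_triangulations pendant_tri_in_triangulations
        colorful_grid_tri colorful_pendant_tri
      by (auto simp: pverts_attach_pendants_grid)
  qed
  finally show ?thesis .
qed

lemma arcs_colorful_flip_graph:
  "(T, T') \<in> arcs (colorful_flip_graph a b) \<longleftrightarrow>
    T \<in> verts (colorful_flip_graph a b) \<and> T' \<in> verts (colorful_flip_graph a b) \<and> flip (a + b + 2) T T'"
  by (auto simp: colorful_flip_graph_def associahedron_def)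

lemma ends_colorful_flip_graph:
  "tail (colorful_flip_graph a b) = fst" "head (colorful_flip_graph a b) = snd"
  by (simp_all add: colorful_flip_graph_def)

lemma flip_node_tri_iff:
  assumes "u \<in> pverts (attach_pendants (grid_graph a b))" "v \<in> pverts (attach_pendants (grid_graph a b))"
  shows "flip (a + b + 2) (node_tri a b u) (node_tri a b v) \<longleftrightarrow>
    (u, v) \<in> parcs (attach_pendants (grid_graph a b))"
  using assms unfolding pverts_attach_pendants_grid
  by (elim UnE imageE; clarsimp simp del: add_2_eq_Suc' simp: flip_grid_grid_iff flip_grid_pendant_iff
      flip_pendant_grid_iff not_flip_pendant_pendant; auto simp: attach_pendants_def grid_graph_def)

theorem theorem4:
  fixes a b :: nat
  assumes "a \<ge> 1" and "b \<ge> 1"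
  shows "digraph_iso (colorful_flip_graph a b) (with_proj (attach_pendants (grid_graph a b))) \<and>
    (\<not> a * b \<le> 2 \<longrightarrow> \<not> has_hamilton_path (colorful_flip_graph a b))"
proof (intro conjI impI notI)
  let ?G = "colorful_flip_graph a b" and ?H = "attach_pendants (grid_graph a b)"
  note verts = verts_colorful_flip_graph[OF assms]
  have arcs: "(node_tri a b u, node_tri a b v) \<in> arcs ?G \<longleftrightarrow> (u, v) \<in> parcs ?H"
    if "u \<in> pverts ?H" "v \<in> pverts ?H" for u v
    using that unfolding arcs_colorful_flip_graph verts flip_node_tri_iff[OF that] by auto
  have wf: "arcs ?G \<subseteq> verts ?G \<times> verts ?G"
    using arcs_colorful_flip_graph by auto
  show "digraph_iso ?G (with_proj ?H)"
  proof (rule digraph_iso_with_projI[OF _ ends_colorful_flip_graph wf _ arcs])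
    show "bij_betw (node_tri a b) (pverts ?H) (verts ?G)"
      using inj_on_node_tri verts by (simp add: bij_betw_def)
    show "parcs ?H \<subseteq> pverts ?H \<times> pverts ?H"
      by (auto simp: attach_pendants_def grid_graph_def)
  qed
  assume "\<not> a * b \<le> 2" and ham: "has_hamilton_path ?G"
  interpret wf_digraph ?G
    using wf by unfold_locales (auto simp: ends_colorful_flip_graph)
  \<comment> \<open>The \<open>a * b\<close> pendant nodes have a single neighbor each, so a
    Hamilton path allows at most two of them.\<close>
  let ?L = "node_tri a b ` Inr ` ({1..a} \<times> {1..b})"
  have sub: "Inr ` ({1..a} \<times> {1..b}) \<subseteq> pverts ?H"
    by (simp add: pverts_attach_pendants_grid)
  have nbr: "u = Inl p" if "(Inr p, u) \<in> parcs ?H \<or> (u, Inr p) \<in> parcs ?H" for p u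
    using that by (auto simp: attach_pendants_def)
  have "card ?L = a * b"
    by (subst card_image[OF inj_on_subset[OF inj_on_node_tri sub]]) (simp add: card_image)
  moreover have "card ?L \<le> 2"
  proof (rule card_leaves_le_2[OF ham])
    show "?L \<subseteq> verts ?G" unfolding verts using sub by (rule image_mono)
    fix x e e'
    assume x: "x \<in> ?L" and e: "e \<in> arcs ?G" "e' \<in> arcs ?G" "head ?G e = x" "tail ?G e' = x"
    obtain p where p: "p \<in> {1..a} \<times> {1..b}" "x = node_tri a b (Inr p)" using x by auto
    then have Inr: "Inr p \<in> pverts ?H" using sub by blast
    obtain u where u: "u \<in> pverts ?H" "e = (node_tri a b u, x)"
      using e wf verts by (cases e) (auto simp: ends_colorful_flip_graph)
    obtain v where v: "v \<in> pverts ?H" "e' = (x, node_tri a b v)"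
      using e wf verts by (cases e') (auto simp: ends_colorful_flip_graph)
    have "u = Inl p" "v = Inl p"
      using nbr e arcs[OF u(1) Inr] arcs[OF Inr v(1)] u v p by auto
    then show "tail ?G e = head ?G e'"
      using u v by (simp add: ends_colorful_flip_graph)
  qed
  ultimately show False using \<open>\<not> a * b \<le> 2\<close> by simp
qed

end
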